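(* Let $(x^*,\sigma^* )\in E$ be any primal-dual optimal solution, $x^*=(\phi^*,P^* )$. Then the optimal line flow vector $P^*$ satisfies $$\sum_{ij\in\mathcal B_k}\hat C_{k,ij}P^*_{ij}=\hat P_k\qquad\text{for all }k\in\mathcal K.$$ Furthermore, if $(x^*,\sigma^* )$ is the limit of a trajectory of the closed-loop system given in the context whose initial line flows satisfy $P(0)=BC^T\theta^0$ for some $\theta^0\in\mathbb R^{|\mathcal N|}$, then $P_{ij}^*=B_{ij}(\phi_i^*-\phi_j^* )$ for all $ij\in\mathcal E$, and therefore $\underline P\le P^*\le\overline P$.
   Context: Network. $(\mathcal N,\mathcal E)$ is a finite connected directed graph with $ij\in\mathcal E\Rightarrow ji\notin\mathcal E$; $\mathcal N_i$ is the set of neighbors of $i$ (ignoring orientation); $\mathcal N=\mathcal G\cup\mathcal L$ is a partition into generator and load buses. Each line $e=ij$ has susceptance $B_{ij}=B_{ji}>0$; $B=\mathrm{diag}(B_e)_{e\in\mathcal E}$. $C\in\mathbb R^{|\mathcal N|\times|\mathcal E|}$ is the incidence matrix: for $e=ij$, $C_{i,e}=1$, $C_{j,e}=-1$, and other entries are $0$. $L_B=CBC^T$. $D_i>0$ for $i\in\mathcal N$, $D=\mathrm{diag}(D_i)$, $M_i>0$ for $i\in\mathcal G$; $P^{in}\in\mathbb R^{|\mathcal N|}$ is given. Areas. $\mathcal K$ is the finite set of control areas, $\mathcal N_k\subseteq\mathcal N$ the buses of area $k$, $\mathcal B_k\subseteq\mathcal E$ the edges with exactly one endpoint in $\mathcal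 N_k$. $\hat C\in\mathbb R^{|\mathcal K|\times|\mathcal E|}$: for $ij\in\mathcal B_k$, $\hat C_{k,ij}=1$ if $i\in\mathcal N_k$ and $-1$ if $j\in\mathcal N_k$; $\hat C_{k,ij}=0$ if $ij\notin\mathcal B_k$. $\hat P\in\mathbb R^{|\mathcal K|}$ and the limits $\overline P,\underline P=-\overline P\in\mathbb R^{|\mathcal E|}$ are given. Assumption 1: $c_i$ is $\alpha$-strongly convex and $C^2$ ($c_i''\ge\alpha>0$) in the interior of $\mathcal D_i=[\underline d_i,\overline d_i]\subseteq\mathbb R$ (possibly unbounded), and $c_i(d_i)\to+\infty$ as $d_i\to\partial\mathcal D_i$. VF-OLC: minimize $\sum_i\big(c_i(d_i)+\tfrac{D_i\omega_i^2}{2}\big)$ over $(d,\omega,\phi,P)$ subject to (a) $P^{in}-(d+D\omega)=CP$, (b) $P^{in}-d=L_B\phi$, (c) $\hat CBC^T\phi=\hat P$, (d) $\underline P\le BC^T\phi\le\overline P$, with Lagrange multipliers $\nu$ for (a), $\lambda$ for (b), $\pi$ for (c), and $\rho^+,\rho^-\ge0$ for the right and left inequalities in (d). Assumption 2: the OLC problem, i.e. minimize $\sum_{i}c_i(d_i)$ over $(d,\omega,\theta)$ subject to $P^{in}-(d+D\omega)=L_B\theta$, $\omega=0$, $\hat CBC^T\theta=\hat P$, $\underline P\le BC^T\theta\le\overline P$, is feasible and has at least one feasible point with $d\in\prod_i\mathrm{Int}\,\mathcal D_i$. Closed-loop system, with positive gains $\zeta,\chi$: $M_i\dot\omega_i=P_i^{in}-(d_i+D_i\omega_i)-\sum_{e}C_{i,e}P_e$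 for $i\in\mathcal G$; $0=P_i^{in}-(d_i+D_i\omega_i)-\sum_{e}C_{i,e}P_e$ for $i\in\mathcal L$; $\dot P_{ij}=B_{ij}(\omega_i-\omega_j)$ for $ij\in\mathcal E$; $\dot\lambda_i=\zeta_i^\lambda\big(P_i^{in}-d_i-\sum_{j\in\mathcal N_i}B_{ij}(\phi_i-\phi_j)\big)$; $\dot\pi_k=\zeta_k^\pi\big(\sum_{ij\in\mathcal B_k}\hat C_{k,ij}B_{ij}(\phi_i-\phi_j)-\hat P_k\big)$; $\dot\rho^+_{ij}=\zeta^{\rho^+}_{ij}[B_{ij}(\phi_i-\phi_j)-\overline P_{ij}]^+_{\rho^+_{ij}}$; $\dot\rho^-_{ij}=\zeta^{\rho^-}_{ij}[\underline P_{ij}-B_{ij}(\phi_i-\phi_j)]^+_{\rho^-_{ij}}$; $\dot\phi_i=\chi_i^\phi\big(\sum_{j\in\mathcal N_i}B_{ij}(\lambda_i-\lambda_j)-\sum_{k\in\mathcal K,e\in\mathcal B_k}C_{i,e}B_e\hat C_{k,e}\pi_k-\sum_{e}C_{i,e}B_e(\rho_e^+-\rho_e^-)\big)$; $d_i=(c_i')^{-1}(\lambda_i+\omega_i)$. Here $[a]^+_u=a$ if $a>0$ or $u>0$, and $0$ otherwise. The state space is restricted to $\rho^+\ge0$, $\rho^-\ge0$ (preserved by the dynamics). Notation. $x=(\phi,P)$, $\sigma=(\lambda,\nu,\pi,\rho^+,\rho^-)$ with the identification $\nu=\omega$. $E$ is the set of equilibrium points of the closed-loop system; equivalently, the set of $(x^*,\sigma^*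 )$ such that, with $\omega^*=\nu^*$ and $d_i^*=(c_i')^{-1}(\lambda_i^*+\nu_i^* )$, $(d^*,\omega^*,\phi^*,P^*,\sigma^* )$ is primal-dual optimal for VF-OLC. *)

theory Defs
  imports "HOL-Analysis.Analysis"
begin

text \<open>
  Buses are the elements of a finite type, lines are ordered pairs of buses, and vectors
  indexed by lines (areas) are functions of which only the values on the set of lines (areas) of
  the network are ever used.
\<close>

type_synonym 'n bvec = "'n \<Rightarrow> real"
type_synonym 'n lvec = "'n \<times> 'n \<Rightarrow> real"
type_synonym ('n, 'k) mults = "'n bvec \<times> 'n bvec \<times> ('k \<Rightarrow> real) \<times> 'n lvec \<times> 'n lvec"
type_synonym ('n, 'k) state = "('n bvec \<times> 'n lvec) \<times> ('n, 'k) mults"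

record ('n, 'k) network =
  lines :: "('n \<times> 'n) set"
  gens :: "'n set"
  loads :: "'n set"
  suscep :: "'n lvec"            \<comment> \<open>\<open>B\<close>\<close>
  damping :: "'n bvec"           \<comment> \<open>\<open>D\<close>\<close>
  inertia :: "'n bvec"           \<comment> \<open>\<open>M\<close>, relevant on \<open>gens\<close> only\<close>
  p_in :: "'n bvec"
  areas :: "'k set"
  area_buses :: "'k \<Rightarrow> 'n set"
  p_sched :: "'k \<Rightarrow> real"        \<comment> \<open>net exports, \<open>P\<close>-hat\<close>
  p_max :: "'n lvec"             \<comment> \<open>upper line limits\<close>
  d_min :: "'n \<Rightarrow> ereal"
  d_max :: "'n \<Rightarrow> ereal"
  cost :: "'n \<Rightarrow> real \<Rightarrow> real"
  gain_lambda :: "'n bvec"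
  gain_pi :: "'k \<Rightarrow> real"
  gain_rho_pos :: "'n lvec"
  gain_rho_neg :: "'n lvec"
  gain_phi :: "'n bvec"


subsection \<open>Network\<close>

definition network_ok :: "('n::finite, 'k) network \<Rightarrow> bool" where
  "network_ok S \<longleftrightarrow>
     (\<forall>i j. (i, j) \<in> lines S \<longrightarrow> (j, i) \<notin> lines S) \<and>
     (\<forall>i j. (i, j) \<in> (lines S \<union> (lines S)\<inverse>)\<^sup>*) \<and>
     gens S \<union> loads S = UNIV \<and> gens S \<inter> loads S = {} \<and>
     (\<forall>(i, j) \<in> lines S. suscep S (i, j) > 0 \<and> suscep S (j, i) = suscep S (i, j)) \<and>
     (\<forall>i. damping S i > 0) \<and>
     (\<forall>i \<in> gens S. inertia S i > 0) \<and>
     finite (areas S)"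

definition gains_pos :: "('n, 'k) network \<Rightarrow> bool" where
  "gains_pos S \<longleftrightarrow>
     (\<forall>i. gain_lambda S i > 0) \<and> (\<forall>i. gain_phi S i > 0) \<and> (\<forall>k \<in> areas S. gain_pi S k > 0) \<and>
     (\<forall>e \<in> lines S. gain_rho_pos S e > 0) \<and> (\<forall>e \<in> lines S. gain_rho_neg S e > 0)"

definition p_min :: "('n, 'k) network \<Rightarrow> 'n lvec" where
  "p_min S e = - p_max S e"

definition nbrs :: "('n, 'k) network \<Rightarrow> 'n \<Rightarrow> 'n set" where
  "nbrs S i = {j. (i, j) \<in> lines S \<or> (j, i) \<in> lines S}"

definition inc :: "('n, 'k) network \<Rightarrow> 'n \<Rightarrow> 'n \<times> 'n \<Rightarrow> real" where
  "inc S i e = (if e \<in> lines S \<and> i = fst e then 1 else if e \<in> lines S \<and> i = snd e then -1 else 0)"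

definition boundary :: "('n, 'k) network \<Rightarrow> 'k \<Rightarrow> ('n \<times> 'n) set" where
  "boundary S k = {(i, j) \<in> lines S. (i \<in> area_buses S k) \<noteq> (j \<in> area_buses S k)}"

definition area_inc :: "('n, 'k) network \<Rightarrow> 'k \<Rightarrow> 'n \<times> 'n \<Rightarrow> real" where
  "area_inc S k e =
     (if e \<in> boundary S k then (if fst e \<in> area_buses S k then 1 else -1) else 0)"

definition inc_mult :: "('n, 'k) network \<Rightarrow> 'n lvec \<Rightarrow> 'n bvec" where
  "inc_mult S P i = (\<Sum>e \<in> lines S. inc S i e * P e)"

definition dc_flow :: "('n::finite, 'k) network \<Rightarrow> 'n bvec \<Rightarrow> 'n lvec" where  \<comment> \<open>\<open>B C\<^sup>T \<theta>\<close>\<close>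
  "dc_flow S \<theta> e = suscep S e * (\<Sum>i \<in> UNIV. inc S i e * \<theta> i)"

definition laplacian :: "('n, 'k) network \<Rightarrow> 'n \<Rightarrow> 'n \<Rightarrow> real" where
  "laplacian S i j = (\<Sum>e \<in> lines S. inc S i e * suscep S e * inc S j e)"

definition lap_mult :: "('n::finite, 'k) network \<Rightarrow> 'n bvec \<Rightarrow> 'n bvec" where
  "lap_mult S \<theta> i = (\<Sum>j \<in> UNIV. laplacian S i j * \<theta> j)"

definition area_mult :: "('n, 'k) network \<Rightarrow> 'n lvec \<Rightarrow> 'k \<Rightarrow> real" where
  "area_mult S P k = (\<Sum>e \<in> lines S. area_inc S k e * P e)"


subsection \<open>Costs\<close>

definition dem_dom :: "('n, 'k) network \<Rightarrow> 'n \<Rightarrow> real set" where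
  "dem_dom S i = {d. d_min S i \<le> ereal d \<and> ereal d \<le> d_max S i}"

text \<open>
  Blow-up at the infinite ends of an unbounded domain is a consequence of strong convexity.
\<close>

definition cost_assm :: "('n, 'k) network \<Rightarrow> bool" where
  "cost_assm S \<longleftrightarrow>
     (\<exists>\<alpha> > 0. \<forall>i.
        cost S i differentiable_on interior (dem_dom S i) \<and>
        deriv (cost S i) differentiable_on interior (dem_dom S i) \<and>
        continuous_on (interior (dem_dom S i)) (deriv (deriv (cost S i))) \<and>
        (\<forall>d \<in> interior (dem_dom S i). deriv (deriv (cost S i)) d \<ge> \<alpha>)) \<and>
     (\<forall>i. \<forall>b \<in> frontier (dem_dom S i).
        filterlim (cost S i) at_top (at b within interior (dem_dom S i)))"

definition ext_cost :: "('n, 'k) network \<Rightarrow> 'n \<Rightarrow> real \<Rightarrow> ereal" where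
  "ext_cost S i d = (if d \<in> interior (dem_dom S i) then ereal (cost S i d) else \<infinity>)"

definition demand :: "('n, 'k) network \<Rightarrow> 'n bvec \<Rightarrow> 'n bvec \<Rightarrow> 'n bvec" where
  "demand S lam \<omega> i = inv_into (interior (dem_dom S i)) (deriv (cost S i)) (lam i + \<omega> i)"


subsection \<open>Optimization problems\<close>

definition olc_feasible ::
  "('n::finite, 'k) network \<Rightarrow> 'n bvec \<times> 'n bvec \<times> 'n bvec \<Rightarrow> bool" where
  "olc_feasible S = (\<lambda>(d, \<omega>, \<theta>).
     (\<forall>i. d i \<in> dem_dom S i) \<and>
     (\<forall>i. p_in S i - (d i + damping S i * \<omega> i) = lap_mult S \<theta> i) \<and>
     (\<forall>i. \<omega> i = 0) \<and>
     (\<forall>k \<in> areas S. area_mult S (dc_flow S \<theta>) k = p_sched S k) \<and>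
     (\<forall>e \<in> lines S. p_min S e \<le> dc_flow S \<theta> e \<and> dc_flow S \<theta> e \<le> p_max S e))"

definition slater_assm :: "('n::finite, 'k) network \<Rightarrow> bool" where
  "slater_assm S \<longleftrightarrow>
     (\<exists>d \<omega> \<theta>. olc_feasible S (d, \<omega>, \<theta>) \<and> (\<forall>i. d i \<in> interior (dem_dom S i)))"

type_synonym 'n primal = "'n bvec \<times> 'n bvec \<times> 'n bvec \<times> 'n lvec"

definition vf_feasible :: "('n::finite, 'k) network \<Rightarrow> 'n primal \<Rightarrow> bool" where
  "vf_feasible S = (\<lambda>(d, \<omega>, \<phi>, P).
     (\<forall>i. p_in S i - (d i + damping S i * \<omega> i) = inc_mult S P i) \<and>
     (\<forall>i. p_in S i - d i = lap_mult S \<phi> i) \<and>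
     (\<forall>k \<in> areas S. area_mult S (dc_flow S \<phi>) k = p_sched S k) \<and>
     (\<forall>e \<in> lines S. p_min S e \<le> dc_flow S \<phi> e \<and> dc_flow S \<phi> e \<le> p_max S e))"

text \<open>
  The objective is extended by \<open>\<infinity>\<close> outside the interior of the domains, in accordance with the
  blow-up of the costs at the boundary.
\<close>

definition vf_cost :: "('n::finite, 'k) network \<Rightarrow> 'n primal \<Rightarrow> ereal" where
  "vf_cost S = (\<lambda>(d, \<omega>, \<phi>, P).
     \<Sum>i \<in> UNIV. ext_cost S i (d i) + ereal (damping S i * (\<omega> i)\<^sup>2 / 2))"

definition vf_primal_optimal :: "('n::finite, 'k) network \<Rightarrow> 'n primal \<Rightarrow> bool" where
  "vf_primal_optimal S x \<longleftrightarrow>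
     vf_feasible S x \<and> (\<forall>y. vf_feasible S y \<longrightarrow> vf_cost S x \<le> vf_cost S y)"

definition vf_lagrangian ::
  "('n::finite, 'k) network \<Rightarrow> 'n primal \<Rightarrow> ('n, 'k) mults \<Rightarrow> ereal" where
  "vf_lagrangian S = (\<lambda>(d, \<omega>, \<phi>, P) (lam, \<nu>, \<pi>, \<rho>p, \<rho>m).
     vf_cost S (d, \<omega>, \<phi>, P) + ereal (
       (\<Sum>i \<in> UNIV. \<nu> i * (p_in S i - (d i + damping S i * \<omega> i) - inc_mult S P i)) +
       (\<Sum>i \<in> UNIV. lam i * (p_in S i - d i - lap_mult S \<phi> i)) +
       (\<Sum>k \<in> areas S. \<pi> k * (area_mult S (dc_flow S \<phi>) k - p_sched S k)) +
       (\<Sum>e \<in> lines S. \<rho>p e * (dc_flow S \<phi> e - p_max S e)) +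
       (\<Sum>e \<in> lines S. \<rho>m e * (p_min S e - dc_flow S \<phi> e))))"

definition vf_dual_feasible :: "('n, 'k) network \<Rightarrow> ('n, 'k) mults \<Rightarrow> bool" where
  "vf_dual_feasible S = (\<lambda>(lam, \<nu>, \<pi>, \<rho>p, \<rho>m). \<forall>e \<in> lines S. \<rho>p e \<ge> 0 \<and> \<rho>m e \<ge> 0)"

definition vf_dual :: "('n::finite, 'k) network \<Rightarrow> ('n, 'k) mults \<Rightarrow> ereal" where
  "vf_dual S \<sigma> = (INF x. vf_lagrangian S x \<sigma>)"

definition vf_dual_optimal :: "('n::finite, 'k) network \<Rightarrow> ('n, 'k) mults \<Rightarrow> bool" where
  "vf_dual_optimal S \<sigma> \<longleftrightarrow>
     vf_dual_feasible S \<sigma> \<and> (\<forall>\<tau>. vf_dual_feasible S \<tau> \<longrightarrow> vf_dual S \<tau> \<le> vf_dual S \<sigma>)"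

text \<open>The primal variables \<open>d\<close> and \<open>\<omega>\<close> are recovered from the multipliers, with \<open>\<omega> = \<nu>\<close>.\<close>

definition primal_dual_optima :: "('n::finite, 'k) network \<Rightarrow> ('n, 'k) state set" where
  "primal_dual_optima S = {((\<phi>, P), (lam, \<nu>, \<pi>, \<rho>p, \<rho>m)) | \<phi> P lam \<nu> \<pi> \<rho>p \<rho>m.
     vf_primal_optimal S (demand S lam \<nu>, \<nu>, \<phi>, P) \<and>
     vf_dual_optimal S (lam, \<nu>, \<pi>, \<rho>p, \<rho>m)}"


subsection \<open>Closed-loop system\<close>

definition proj_pos :: "real \<Rightarrow> real \<Rightarrow> real" where
  "proj_pos a u = (if a > 0 \<or> u > 0 then a else 0)"

text \<open>\<open>imbalance\<close> is both \<open>M\<^sub>i\<close> times the derivative of \<open>\<omega>\<^sub>i\<close> at a generator and the algebraic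
  constraint at a load.\<close>

definition imbalance :: "('n::finite, 'k) network \<Rightarrow> ('n, 'k) state \<Rightarrow> 'n \<Rightarrow> real" where
  "imbalance S = (\<lambda>((\<phi>, P), (lam, \<omega>, \<pi>, \<rho>p, \<rho>m)) i.
     p_in S i - (demand S lam \<omega> i + damping S i * \<omega> i) - (\<Sum>e \<in> lines S. inc S i e * P e))"

definition omega_rhs :: "('n::finite, 'k) network \<Rightarrow> ('n, 'k) state \<Rightarrow> 'n \<Rightarrow> real" where
  "omega_rhs S z i = imbalance S z i / inertia S i"

definition flow_rhs :: "('n::finite, 'k) network \<Rightarrow> ('n, 'k) state \<Rightarrow> 'n \<times> 'n \<Rightarrow> real" where
  "flow_rhs S = (\<lambda>((\<phi>, P), (lam, \<omega>, \<pi>, \<rho>p, \<rho>m)) (i, j).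
     suscep S (i, j) * (\<omega> i - \<omega> j))"

definition lambda_rhs :: "('n::finite, 'k) network \<Rightarrow> ('n, 'k) state \<Rightarrow> 'n \<Rightarrow> real" where
  "lambda_rhs S = (\<lambda>((\<phi>, P), (lam, \<omega>, \<pi>, \<rho>p, \<rho>m)) i.
     gain_lambda S i *
       (p_in S i - demand S lam \<omega> i - (\<Sum>j \<in> nbrs S i. suscep S (i, j) * (\<phi> i - \<phi> j))))"

definition pi_rhs :: "('n::finite, 'k) network \<Rightarrow> ('n, 'k) state \<Rightarrow> 'k \<Rightarrow> real" where
  "pi_rhs S = (\<lambda>((\<phi>, P), (lam, \<omega>, \<pi>, \<rho>p, \<rho>m)) k.
     gain_pi S k *
       ((\<Sum>(i, j) \<in> boundary S k. area_inc S k (i, j) * suscep S (i, j) * (\<phi> i - \<phi> j))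
        - p_sched S k))"

definition rho_pos_rhs :: "('n::finite, 'k) network \<Rightarrow> ('n, 'k) state \<Rightarrow> 'n \<times> 'n \<Rightarrow> real" where
  "rho_pos_rhs S = (\<lambda>((\<phi>, P), (lam, \<omega>, \<pi>, \<rho>p, \<rho>m)) (i, j).
     gain_rho_pos S (i, j) *
       proj_pos (suscep S (i, j) * (\<phi> i - \<phi> j) - p_max S (i, j)) (\<rho>p (i, j)))"

definition rho_neg_rhs :: "('n::finite, 'k) network \<Rightarrow> ('n, 'k) state \<Rightarrow> 'n \<times> 'n \<Rightarrow> real" where
  "rho_neg_rhs S = (\<lambda>((\<phi>, P), (lam, \<omega>, \<pi>, \<rho>p, \<rho>m)) (i, j).
     gain_rho_neg S (i, j) *
       proj_pos (p_min S (i, j) - suscep S (i, j) * (\<phi> i - \<phi> j)) (\<rho>m (i, j)))"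

definition phi_rhs :: "('n::finite, 'k) network \<Rightarrow> ('n, 'k) state \<Rightarrow> 'n \<Rightarrow> real" where
  "phi_rhs S = (\<lambda>((\<phi>, P), (lam, \<omega>, \<pi>, \<rho>p, \<rho>m)) i.
     gain_phi S i *
       ((\<Sum>j \<in> nbrs S i. suscep S (i, j) * (lam i - lam j))
        - (\<Sum>k \<in> areas S. \<Sum>e \<in> boundary S k. inc S i e * suscep S e * area_inc S k e * \<pi> k)
        - (\<Sum>e \<in> lines S. inc S i e * suscep S e * (\<rho>p e - \<rho>m e))))"

text \<open>The state space is restricted to nonnegative \<open>\<rho>p\<close> and \<open>\<rho>m\<close>.\<close>

definition in_state_space :: "('n, 'k) network \<Rightarrow> ('n, 'k) state \<Rightarrow> bool" where
  "in_state_space S = (\<lambda>((\<phi>, P), (lam, \<omega>, \<pi>, \<rho>p, \<rho>m)).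
     \<forall>e \<in> lines S. \<rho>p e \<ge> 0 \<and> \<rho>m e \<ge> 0)"

definition equilibria :: "('n::finite, 'k) network \<Rightarrow> ('n, 'k) state set" where
  "equilibria S = {z. in_state_space S z \<and>
     (\<forall>i \<in> gens S. omega_rhs S z i = 0) \<and>
     (\<forall>i \<in> loads S. imbalance S z i = 0) \<and>
     (\<forall>e \<in> lines S. flow_rhs S z e = 0) \<and>
     (\<forall>i. lambda_rhs S z i = 0) \<and>
     (\<forall>k \<in> areas S. pi_rhs S z k = 0) \<and>
     (\<forall>e \<in> lines S. rho_pos_rhs S z e = 0) \<and>
     (\<forall>e \<in> lines S. rho_neg_rhs S z e = 0) \<and>
     (\<forall>i. phi_rhs S z i = 0)}"

abbreviation (input) s_phi :: "('n, 'k) state \<Rightarrow> 'n bvec" where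
  "s_phi z \<equiv> fst (fst z)"
abbreviation (input) s_flow :: "('n, 'k) state \<Rightarrow> 'n lvec" where
  "s_flow z \<equiv> snd (fst z)"
abbreviation (input) s_lambda :: "('n, 'k) state \<Rightarrow> 'n bvec" where
  "s_lambda z \<equiv> fst (snd z)"
abbreviation (input) s_omega :: "('n, 'k) state \<Rightarrow> 'n bvec" where
  "s_omega z \<equiv> fst (snd (snd z))"
abbreviation (input) s_pi :: "('n, 'k) state \<Rightarrow> 'k \<Rightarrow> real" where
  "s_pi z \<equiv> fst (snd (snd (snd z)))"
abbreviation (input) s_rho_pos :: "('n, 'k) state \<Rightarrow> 'n lvec" where
  "s_rho_pos z \<equiv> fst (snd (snd (snd (snd z))))"
abbreviation (input) s_rho_neg :: "('n, 'k) state \<Rightarrow> 'n lvec" where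
  "s_rho_neg z \<equiv> snd (snd (snd (snd (snd z))))"

text \<open>
  The right-hand side is discontinuous in \<open>\<rho>p\<close> and \<open>\<rho>m\<close>, so trajectories are Caratheodory
  solutions: locally absolutely continuous functions on the nonnegative half-line which satisfy
  the differential equations almost everywhere, expressed by the integral equation.
\<close>

definition carath_deriv :: "(real \<Rightarrow> real) \<Rightarrow> (real \<Rightarrow> real) \<Rightarrow> bool" where
  "carath_deriv x f \<longleftrightarrow>
     (\<forall>t \<ge> 0. f absolutely_integrable_on {0..t} \<and> x t = x 0 + integral {0..t} f)"

definition trajectory :: "('n::finite, 'k) network \<Rightarrow> (real \<Rightarrow> ('n, 'k) state) \<Rightarrow> bool" where
  "trajectory S z \<longleftrightarrow>
     (\<forall>t \<ge> 0. in_state_space S (z t)) \<and>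
     (\<forall>i \<in> gens S. carath_deriv (\<lambda>t. s_omega (z t) i) (\<lambda>t. omega_rhs S (z t) i)) \<and>
     (\<forall>i \<in> loads S. \<forall>t \<ge> 0. imbalance S (z t) i = 0) \<and>
     (\<forall>e \<in> lines S. carath_deriv (\<lambda>t. s_flow (z t) e) (\<lambda>t. flow_rhs S (z t) e)) \<and>
     (\<forall>i. carath_deriv (\<lambda>t. s_lambda (z t) i) (\<lambda>t. lambda_rhs S (z t) i)) \<and>
     (\<forall>k \<in> areas S. carath_deriv (\<lambda>t. s_pi (z t) k) (\<lambda>t. pi_rhs S (z t) k)) \<and>
     (\<forall>e \<in> lines S. carath_deriv (\<lambda>t. s_rho_pos (z t) e) (\<lambda>t. rho_pos_rhs S (z t) e)) \<and>
     (\<forall>e \<in> lines S. carath_deriv (\<lambda>t. s_rho_neg (z t) e) (\<lambda>t. rho_neg_rhs S (z t) e)) \<and>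
     (\<forall>i. carath_deriv (\<lambda>t. s_phi (z t) i) (\<lambda>t. phi_rhs S (z t) i))"

definition converges_to ::
  "('n, 'k) network \<Rightarrow> (real \<Rightarrow> ('n, 'k) state) \<Rightarrow> ('n, 'k) state \<Rightarrow> bool" where
  "converges_to S z zs \<longleftrightarrow>
     (\<forall>i. ((\<lambda>t. s_phi (z t) i) \<longlongrightarrow> s_phi zs i) at_top) \<and>
     (\<forall>e \<in> lines S. ((\<lambda>t. s_flow (z t) e) \<longlongrightarrow> s_flow zs e) at_top) \<and>
     (\<forall>i. ((\<lambda>t. s_lambda (z t) i) \<longlongrightarrow> s_lambda zs i) at_top) \<and>
     (\<forall>i. ((\<lambda>t. s_omega (z t) i) \<longlongrightarrow> s_omega zs i) at_top) \<and>
     (\<forall>k \<in> areas S. ((\<lambda>t. s_pi (z t) k) \<longlongrightarrow> s_pi zs k) at_top) \<and>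
     (\<forall>e \<in> lines S. ((\<lambda>t. s_rho_pos (z t) e) \<longlongrightarrow> s_rho_pos zs e) at_top) \<and>
     (\<forall>e \<in> lines S. ((\<lambda>t. s_rho_neg (z t) e) \<longlongrightarrow> s_rho_neg zs e) at_top)"

end

theory Submission
  imports Defs
begin

text \<open>
  Both claims rest on the identity \<open>C P = L\<^sub>B \<phi> = C (B C\<^sup>T \<phi>)\<close>: the actual flow \<open>P\<close> and the virtual
  flow \<open>B C\<^sup>T \<phi>\<close> have the same net outflow at every bus. Subtracting the balance equations (a) and
  (b) of VF-OLC shows that it says no more than \<open>\<omega> = 0\<close>. At an equilibrium, the line equation
  makes \<open>\<omega>\<close> constant on the connected network, and summing the balance equations over all buses
  gives \<open>\<Sum>\<^sub>i D\<^sub>i \<omega>\<^sub>i = 0\<close>, so the constant is zero (\<open>equilibrium_balance\<close>). At an optimum, replacing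
  \<open>(\<omega>, P)\<close> by \<open>(0, B C\<^sup>T \<phi>)\<close> keeps feasibility and saves the cost
  \<open>\<Sum>\<^sub>i D\<^sub>i \<omega>\<^sub>i\<^sup>2 / 2\<close>, which must therefore be zero (\<open>optimal_frequency_zero\<close>). The net export
  of an area is the sum of the outflows of its buses, hence it is the same for \<open>P\<close> and for \<open>B C\<^sup>T \<phi>\<close>, and for the latter it is
  the scheduled value.

  For the second claim, each \<open>P(t)\<close> stays in the range of \<open>B C\<^sup>T\<close>, because its derivative
  \<open>B C\<^sup>T \<omega>\<close> lies there (\<open>trajectory_flow_has_potential\<close>), and so does the limit \<open>P\<^sup>*\<close>
  (\<open>limit_of_potential_flows\<close>). On that range \<open>C\<close> is injective: if \<open>C B C\<^sup>T u = 0\<close>, then the energy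
  \<open>\<Sum>\<^sub>i\<^sub>j B\<^sub>i\<^sub>j (u\<^sub>i - u\<^sub>j)\<^sup>2 = u\<^sup>T C B C\<^sup>T u\<close> vanishes (\<open>dc_flow_eq_of_inc_mult_eq\<close>). So the identity
  forces \<open>P\<^sup>* = B C\<^sup>T \<phi>\<^sup>*\<close>, and the limits imposed on the virtual flow hold for \<open>P\<^sup>*\<close>.
\<close>


section \<open>Incidence and flows\<close>

lemma line_irrefl: "network_ok S \<Longrightarrow> (i, i) \<notin> lines S"
  unfolding network_ok_def by blast

lemma network_connected_induct:
  assumes "network_ok S"
    and "\<And>i. R i i"
    and "\<And>i j. (i, j) \<in> lines S \<Longrightarrow> R i j"
    and "\<And>i j. R i j \<Longrightarrow> R j i"
    and "\<And>i j k. R i j \<Longrightarrow> R j k \<Longrightarrow> R i k"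
  shows "R i j"
proof -
  have "(i, j) \<in> (lines S \<union> (lines S)\<inverse>)\<^sup>*"
    using assms(1) unfolding network_ok_def by blast
  then show ?thesis
  proof (induction rule: rtrancl_induct)
    case base
    show ?case by (rule assms(2))
  next
    case (step j k)
    then have "R j k" using assms(3,4) by blast
    with step.IH show ?case by (rule assms(5))
  qed
qed

lemma sum_inc_mult_line:
  fixes S :: "('n::finite, 'k) network"
  assumes "network_ok S" "(i, j) \<in> lines S"
  shows "(\<Sum>l \<in> UNIV. inc S l (i, j) * u l) = u i - u j"
proof -
  have "i \<noteq> j" using line_irrefl[OF assms(1)] assms(2) by blast
  then have "(\<Sum>l \<in> UNIV. inc S l (i, j) * u l) = (\<Sum>l \<in> {i, j}. inc S l (i, j) * u l)"
    by (intro sum.mono_neutral_right) (auto simp: inc_def)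
  also have "\<dots> = u i - u j"
    using \<open>i \<noteq> j\<close> assms(2) by (simp add: inc_def)
  finally show ?thesis .
qed

lemma dc_flow_line:
  assumes "network_ok S" "(i, j) \<in> lines S"
  shows "dc_flow S \<theta> (i, j) = suscep S (i, j) * (\<theta> i - \<theta> j)"
  by (simp add: dc_flow_def sum_inc_mult_line[OF assms])

lemma suscep_pos: "network_ok S \<Longrightarrow> e \<in> lines S \<Longrightarrow> suscep S e > 0"
  unfolding network_ok_def by fast

lemma suscep_sym: "network_ok S \<Longrightarrow> (i, j) \<in> lines S \<Longrightarrow> suscep S (j, i) = suscep S (i, j)"
  unfolding network_ok_def by fast

lemma lap_mult_eq: "lap_mult S \<theta> i = inc_mult S (dc_flow S \<theta>) i"
  unfolding lap_mult_def laplacian_def inc_mult_def dc_flow_def sum_distrib_left sum_distrib_right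
  by (subst sum.swap) (simp add: mult_ac)

text \<open>
  Summation by parts on the network (\<open>u\<^sup>T (C P) = (C\<^sup>T u)\<^sup>T P\<close>). It is used with \<open>u\<close> constant, with
  the indicator of an area, and with a difference of two potentials.
\<close>

lemma inc_mult_adjoint:
  fixes S :: "('n::finite, 'k) network"
  assumes "network_ok S"
  shows "(\<Sum>i \<in> UNIV. u i * inc_mult S P i) = (\<Sum>(i, j) \<in> lines S. (u i - u j) * P (i, j))"
proof -
  have "(\<Sum>i \<in> UNIV. u i * inc_mult S P i)
      = (\<Sum>e \<in> lines S. (\<Sum>i \<in> UNIV. inc S i e * u i) * P e)"
    unfolding inc_mult_def sum_distrib_left sum_distrib_right
    by (subst sum.swap) (simp add: mult_ac)
  also have "\<dots> = (\<Sum>(i, j) \<in> lines S. (u i - u j) * P (i, j))"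
    by (intro sum.cong refl) (auto simp: sum_inc_mult_line[OF assms])
  finally show ?thesis .
qed

text \<open>Lines inside an area cancel, so only the boundary lines contribute to its net export.\<close>

lemma area_export:
  fixes S :: "('n::finite, 'k) network"
  assumes "network_ok S"
  shows "(\<Sum>e \<in> boundary S k. area_inc S k e * P e) = (\<Sum>i \<in> area_buses S k. inc_mult S P i)"
proof -
  have "(\<Sum>i \<in> area_buses S k. inc_mult S P i)
      = (\<Sum>i \<in> UNIV. indicator (area_buses S k) i * inc_mult S P i)"
    by (simp add: sum.If_cases indicator_def)
  also have "\<dots> = (\<Sum>(i, j) \<in> lines S.
      (indicator (area_buses S k) i - indicator (area_buses S k) j) * P (i, j))"
    by (rule inc_mult_adjoint[OF assms])
  also have "\<dots> = (\<Sum>e \<in> boundary S k. area_inc S k e * P e)"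
    by (rule sum.mono_neutral_cong_right)
      (auto simp: boundary_def area_inc_def indicator_def split: if_splits)
  finally show ?thesis by simp
qed

lemma area_mult_boundary:
  fixes S :: "('n::finite, 'k) network"
  shows "area_mult S P k = (\<Sum>e \<in> boundary S k. area_inc S k e * P e)"
  unfolding area_mult_def
  by (rule sum.mono_neutral_right) (auto simp: boundary_def area_inc_def)

text \<open>
  The closed-loop system sums over neighbours and the optimization problem over lines. A line is
  met from both of its ends, and the two signs of \<open>inc\<close> orient its flow away from \<open>i\<close> either way.
\<close>

lemma neighbour_sum:
  fixes S :: "('n::finite, 'k) network"
  assumes "network_ok S"
  shows "(\<Sum>j \<in> nbrs S i. suscep S (i, j) * (\<phi> i - \<phi> j)) = inc_mult S (dc_flow S \<phi>) i"
proof -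
  let ?out = "{j. (i, j) \<in> lines S}" and ?in = "{j. (j, i) \<in> lines S}"
  let ?f = "\<lambda>j. suscep S (i, j) * (\<phi> i - \<phi> j)"
  let ?g = "\<lambda>e. inc S i e * dc_flow S \<phi> e"
  have disj: "?out \<inter> ?in = {}"
    using assms unfolding network_ok_def by blast
  have disj': "Pair i ` ?out \<inter> (\<lambda>j. (j, i)) ` ?in = {}"
    using line_irrefl[OF assms] by auto
  have "inc_mult S (dc_flow S \<phi>) i = sum ?g (Pair i ` ?out \<union> (\<lambda>j. (j, i)) ` ?in)"
    unfolding inc_mult_def by (rule sum.mono_neutral_right) (auto simp: inc_def)
  also have "\<dots> = (\<Sum>j \<in> ?out. ?g (i, j)) + (\<Sum>j \<in> ?in. ?g (j, i))"
    using disj' by (subst sum.union_disjoint) (auto simp: sum.reindex inj_on_def)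
  also have "(\<Sum>j \<in> ?out. ?g (i, j)) = sum ?f ?out"
    by (intro sum.cong refl) (auto simp: inc_def dc_flow_line[OF assms])
  also have "(\<Sum>j \<in> ?in. ?g (j, i)) = sum ?f ?in"
  proof (intro sum.cong refl)
    fix j assume "j \<in> ?in"
    then have ji: "(j, i) \<in> lines S" by simp
    then have "i \<noteq> j" using line_irrefl[OF assms] by blast
    with ji show "?g (j, i) = ?f j"
      by (simp add: inc_def dc_flow_line[OF assms ji] suscep_sym[OF assms ji] algebra_simps)
  qed
  also have "sum ?f ?out + sum ?f ?in = sum ?f (?out \<union> ?in)"
    using disj by (subst sum.union_disjoint) auto
  also have "?out \<union> ?in = nbrs S i"
    unfolding nbrs_def by blast
  finally show ?thesis by simp
qed

text \<open>The energy argument: \<open>C\<close> is injective on the range of \<open>B C\<^sup>T\<close>.\<close>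

lemma dc_flow_eq_of_inc_mult_eq:
  fixes S :: "('n::finite, 'k) network"
  assumes net: "network_ok S"
    and eq: "\<And>i. inc_mult S (dc_flow S \<psi>) i = inc_mult S (dc_flow S \<phi>) i"
    and e: "e \<in> lines S"
  shows "dc_flow S \<psi> e = dc_flow S \<phi> e"
proof -
  let ?u = "\<lambda>i. \<psi> i - \<phi> i"
  have "(\<Sum>(i, j) \<in> lines S. suscep S (i, j) * (?u i - ?u j)\<^sup>2)
      = (\<Sum>(i, j) \<in> lines S. (?u i - ?u j) * dc_flow S \<psi> (i, j))
        - (\<Sum>(i, j) \<in> lines S. (?u i - ?u j) * dc_flow S \<phi> (i, j))"
    unfolding sum_subtractf[symmetric]
    by (intro sum.cong refl)
      (auto simp: dc_flow_line[OF net] power2_eq_square algebra_simps)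
  also have "\<dots> = 0"
    using inc_mult_adjoint[OF net, of ?u "dc_flow S \<psi>"]
      inc_mult_adjoint[OF net, of ?u "dc_flow S \<phi>"]
    by (simp add: eq)
  finally have "\<forall>e \<in> lines S. (case e of (i, j) \<Rightarrow> suscep S (i, j) * (?u i - ?u j)\<^sup>2) = 0"
    using suscep_pos[OF net]
    by (subst (asm) sum_nonneg_eq_0_iff) (auto simp: less_imp_le)
  moreover obtain i j where "e = (i, j)" by fastforce
  ultimately have "\<psi> i - \<psi> j = \<phi> i - \<phi> j"
    using suscep_pos[OF net e] e by fastforce
  then show ?thesis
    using e \<open>e = (i, j)\<close> by (simp add: dc_flow_line[OF net])
qed


section \<open>Equilibria and optima\<close>

lemma proj_pos_eq_0_imp_le: "proj_pos a u = 0 \<Longrightarrow> a \<le> 0"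
  unfolding proj_pos_def by (auto split: if_splits)

lemma equilibrium_balance:
  fixes S :: "('n::finite, 'k) network"
  assumes net: "network_ok S" and gains: "gains_pos S"
    and eq: "((\<phi>, P), \<sigma>) \<in> equilibria S"
  shows "inc_mult S P i = inc_mult S (dc_flow S \<phi>) i"
    and "k \<in> areas S \<Longrightarrow> area_mult S (dc_flow S \<phi>) k = p_sched S k"
    and "e \<in> lines S \<Longrightarrow> p_min S e \<le> dc_flow S \<phi> e \<and> dc_flow S \<phi> e \<le> p_max S e"
proof -
  obtain lam \<omega> \<pi> \<rho>p \<rho>m where \<sigma>: "\<sigma> = (lam, \<omega>, \<pi>, \<rho>p, \<rho>m)"
    using prod_cases5 by blast
  let ?z = "((\<phi>, P), lam, \<omega>, \<pi>, \<rho>p, \<rho>m)"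
  have gen: "\<And>i. i \<in> gens S \<Longrightarrow> omega_rhs S ?z i = 0"
    and load: "\<And>i. i \<in> loads S \<Longrightarrow> imbalance S ?z i = 0"
    and flow: "\<And>e. e \<in> lines S \<Longrightarrow> flow_rhs S ?z e = 0"
    and lambda: "\<And>i. lambda_rhs S ?z i = 0"
    and area: "\<And>k. k \<in> areas S \<Longrightarrow> pi_rhs S ?z k = 0"
    and rho: "\<And>e. e \<in> lines S \<Longrightarrow> rho_pos_rhs S ?z e = 0"
      "\<And>e. e \<in> lines S \<Longrightarrow> rho_neg_rhs S ?z e = 0"
    using eq unfolding equilibria_def \<sigma> by simp_all
  have bal: "p_in S i - (demand S lam \<omega> i + damping S i * \<omega> i) = inc_mult S P i" for i
  proof -
    have "i \<in> gens S \<or> i \<in> loads S" "i \<in> gens S \<Longrightarrow> inertia S i > 0"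
      using net unfolding network_ok_def by auto
    then have "imbalance S ?z i = 0"
      using gen[of i] load[of i] unfolding omega_rhs_def by auto
    then show ?thesis by (simp add: imbalance_def inc_mult_def)
  qed
  have virt: "p_in S i - demand S lam \<omega> i = inc_mult S (dc_flow S \<phi>) i" for i
  proof -
    have "gain_lambda S i > 0" using gains unfolding gains_pos_def by blast
    then show ?thesis
      using lambda[of i] by (simp add: lambda_rhs_def neighbour_sum[OF net])
  qed
  have const: "\<omega> i = \<omega> j" for i j
  proof (rule network_connected_induct[OF net, where R = "\<lambda>i j. \<omega> i = \<omega> j"])
    fix i j assume ij: "(i, j) \<in> lines S"
    then have "suscep S (i, j) * (\<omega> i - \<omega> j) = 0"
      using flow[OF ij] by (simp add: flow_rhs_def)
    then show "\<omega> i = \<omega> j" using suscep_pos[OF net ij] by simp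
  qed auto
  \<comment> \<open>Net outflows add up to zero over the network, so the damping terms do, too.\<close>
  have total: "(\<Sum>i \<in> UNIV. inc_mult S Q i) = 0" for Q
    using inc_mult_adjoint[OF net, of "\<lambda>_. 1" Q] by simp
  have "(\<Sum>i \<in> UNIV. damping S i * \<omega> i)
      = (\<Sum>i \<in> UNIV. inc_mult S (dc_flow S \<phi>) i) - (\<Sum>i \<in> UNIV. inc_mult S P i)"
    unfolding sum_subtractf[symmetric] bal[symmetric] virt[symmetric] by simp
  then have "(\<Sum>j \<in> UNIV. damping S j * \<omega> j) = 0" by (simp add: total)
  moreover have "(\<Sum>j \<in> UNIV. damping S j * \<omega> j) = (\<Sum>j \<in> UNIV. damping S j) * \<omega> i"
    unfolding sum_distrib_right using const by (intro sum.cong) auto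
  moreover have "(\<Sum>j \<in> UNIV. damping S j) > 0"
    using net unfolding network_ok_def by (intro sum_pos) auto
  ultimately have "\<omega> i = 0" by simp
  then show "inc_mult S P i = inc_mult S (dc_flow S \<phi>) i"
    using bal[of i] virt[of i] by simp
  show "area_mult S (dc_flow S \<phi>) k = p_sched S k" if k: "k \<in> areas S"
  proof -
    have "gain_pi S k > 0" using gains k unfolding gains_pos_def by blast
    then have "(\<Sum>(i, j) \<in> boundary S k. area_inc S k (i, j) * suscep S (i, j) * (\<phi> i - \<phi> j))
        = p_sched S k"
      using area[OF k] by (simp add: pi_rhs_def)
    moreover have "area_mult S (dc_flow S \<phi>) k =
        (\<Sum>(i, j) \<in> boundary S k. area_inc S k (i, j) * suscep S (i, j) * (\<phi> i - \<phi> j))"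
      unfolding area_mult_boundary
      by (intro sum.cong refl) (auto simp: boundary_def dc_flow_line[OF net])
    ultimately show ?thesis by simp
  qed
  show "p_min S e \<le> dc_flow S \<phi> e \<and> dc_flow S \<phi> e \<le> p_max S e" if e: "e \<in> lines S"
  proof -
    obtain i j where ij: "e = (i, j)" by fastforce
    have "gain_rho_pos S e > 0" "gain_rho_neg S e > 0"
      using gains e unfolding gains_pos_def by auto
    then have "proj_pos (dc_flow S \<phi> e - p_max S e) (\<rho>p e) = 0"
      "proj_pos (p_min S e - dc_flow S \<phi> e) (\<rho>m e) = 0"
      using rho[OF e] e unfolding ij
      by (simp_all add: rho_pos_rhs_def rho_neg_rhs_def dc_flow_line[OF net])
    from this[THEN proj_pos_eq_0_imp_le] show ?thesis by simp
  qed
qed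

lemma vf_cost_interior:
  assumes "\<And>i. d i \<in> interior (dem_dom S i)"
  shows "vf_cost S (d, \<omega>, \<phi>, P)
    = ereal ((\<Sum>i \<in> UNIV. cost S i (d i)) + (\<Sum>i \<in> UNIV. damping S i * (\<omega> i)\<^sup>2 / 2))"
  using assms by (simp add: vf_cost_def ext_cost_def sum.distrib)

lemma vf_cost_finite_imp_interior:
  assumes "vf_cost S (d, \<omega>, \<phi>, P) < \<infinity>"
  shows "d i \<in> interior (dem_dom S i)"
proof (rule ccontr)
  assume "d i \<notin> interior (dem_dom S i)"
  then have "ext_cost S i (d i) + ereal (damping S i * (\<omega> i)\<^sup>2 / 2) = \<infinity>"
    by (simp add: ext_cost_def)
  then have "vf_cost S (d, \<omega>, \<phi>, P) = \<infinity>"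
    unfolding vf_cost_def prod.case by (subst sum_Pinfty) auto
  with assms show False by simp
qed

text \<open>
  The comparison with \<open>(0, B C\<^sup>T \<phi>)\<close> forces \<open>\<omega> = 0\<close> only if the optimal cost is finite. This is
  where the interior feasible point of OLC is needed.
\<close>

lemma optimal_frequency_zero:
  fixes S :: "('n::finite, 'k) network"
  assumes net: "network_ok S" and slater: "slater_assm S"
    and opt: "vf_primal_optimal S (d, \<omega>, \<phi>, P)"
  shows "\<omega> i = 0"
proof -
  have feas: "vf_feasible S (d, \<omega>, \<phi>, P)"
    and le: "\<And>y. vf_feasible S y \<Longrightarrow> vf_cost S (d, \<omega>, \<phi>, P) \<le> vf_cost S y"
    using opt unfolding vf_primal_optimal_def by auto
  obtain d' \<omega>' \<theta> where olc: "olc_feasible S (d', \<omega>', \<theta>)"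
    and int: "\<And>i. d' i \<in> interior (dem_dom S i)"
    using slater unfolding slater_assm_def by blast
  have "\<omega>' = (\<lambda>_. 0)"
    using olc unfolding olc_feasible_def by auto
  then have "vf_feasible S (d', \<omega>', \<theta>, dc_flow S \<theta>)"
    using olc unfolding olc_feasible_def vf_feasible_def
    by (simp add: lap_mult_eq[symmetric])
  from le[OF this] have "vf_cost S (d, \<omega>, \<phi>, P) < \<infinity>"
    unfolding vf_cost_interior[OF int] by (rule le_less_trans) simp
  then have int': "\<And>i. d i \<in> interior (dem_dom S i)"
    by (rule vf_cost_finite_imp_interior)
  have "vf_feasible S (d, (\<lambda>_. 0), \<phi>, dc_flow S \<phi>)"
    using feas unfolding vf_feasible_def by (simp add: lap_mult_eq[symmetric])
  from le[OF this] have "(\<Sum>i \<in> UNIV. damping S i * (\<omega> i)\<^sup>2 / 2) \<le> 0"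
    by (simp add: vf_cost_interior[OF int'])
  moreover have D: "damping S j > 0" for j
    using net unfolding network_ok_def by blast
  moreover have "damping S i * (\<omega> i)\<^sup>2 / 2 \<le> (\<Sum>i \<in> UNIV. damping S i * (\<omega> i)\<^sup>2 / 2)"
    using D by (intro member_le_sum) (auto simp: less_imp_le)
  ultimately have "damping S i * (\<omega> i)\<^sup>2 \<le> 0" by linarith
  then show ?thesis using D[of i] by (simp add: mult_le_0_iff)
qed

lemma optimum_balance:
  fixes S :: "('n::finite, 'k) network"
  assumes net: "network_ok S" and slater: "slater_assm S"
    and opt: "((\<phi>, P), \<sigma>) \<in> primal_dual_optima S"
  shows "inc_mult S P i = inc_mult S (dc_flow S \<phi>) i"
    and "k \<in> areas S \<Longrightarrow> area_mult S (dc_flow S \<phi>) k = p_sched S k"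
    and "e \<in> lines S \<Longrightarrow> p_min S e \<le> dc_flow S \<phi> e \<and> dc_flow S \<phi> e \<le> p_max S e"
proof -
  obtain d \<omega> where opt': "vf_primal_optimal S (d, \<omega>, \<phi>, P)"
    using opt unfolding primal_dual_optima_def by blast
  then have feas: "vf_feasible S (d, \<omega>, \<phi>, P)"
    unfolding vf_primal_optimal_def by blast
  have "\<omega> i = 0" by (rule optimal_frequency_zero[OF net slater opt'])
  moreover have "p_in S i - (d i + damping S i * \<omega> i) = inc_mult S P i"
    "p_in S i - d i = lap_mult S \<phi> i"
    using feas unfolding vf_feasible_def by auto
  ultimately show "inc_mult S P i = inc_mult S (dc_flow S \<phi>) i"
    by (simp add: lap_mult_eq)
qed (use opt in \<open>auto simp: primal_dual_optima_def vf_primal_optimal_def vf_feasible_def\<close>)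


section \<open>Flows along trajectories\<close>

text \<open>
  The potential is obtained by integrating \<open>\<omega>\<^sub>i - \<omega>\<^sub>r\<close> for a fixed bus \<open>r\<close>, rather than \<open>\<omega>\<^sub>i\<close>: the
  equation of a load bus is algebraic and gives no integrability of \<open>\<omega>\<^sub>i\<close> by itself, whereas the
  line equations make the difference integrable, as a sum of line differences along a path from
  \<open>r\<close> to \<open>i\<close>.
\<close>

lemma trajectory_flow_has_potential:
  fixes S :: "('n::finite, 'k) network"
  assumes net: "network_ok S" and traj: "trajectory S z"
    and init: "\<forall>e \<in> lines S. s_flow (z 0) e = dc_flow S \<theta>0 e"
    and t: "t \<ge> 0"
  shows "\<exists>\<theta>. \<forall>e \<in> lines S. s_flow (z t) e = dc_flow S \<theta> e"
proof -
  define w where "w = (\<lambda>s. s_omega (z s))"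
  have rhs: "flow_rhs S (z s) (i, j) = suscep S (i, j) * (w s i - w s j)" for s i j
    by (simp add: flow_rhs_def w_def split: prod.split)
  have line: "(\<lambda>s. suscep S (i, j) * (w s i - w s j)) integrable_on {0..t}"
    and flow: "s_flow (z t) (i, j)
      = s_flow (z 0) (i, j) + integral {0..t} (\<lambda>s. suscep S (i, j) * (w s i - w s j))"
    if "(i, j) \<in> lines S" for i j
  proof -
    have "carath_deriv (\<lambda>s. s_flow (z s) (i, j)) (\<lambda>s. suscep S (i, j) * (w s i - w s j))"
      using traj that unfolding trajectory_def rhs[symmetric] by blast
    then have abs: "(\<lambda>s. suscep S (i, j) * (w s i - w s j)) absolutely_integrable_on {0..t}"
      and eq: "s_flow (z t) (i, j)
        = s_flow (z 0) (i, j) + integral {0..t} (\<lambda>s. suscep S (i, j) * (w s i - w s j))"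
      using t unfolding carath_deriv_def by blast+
    show "(\<lambda>s. suscep S (i, j) * (w s i - w s j)) integrable_on {0..t}"
      by (rule set_lebesgue_integral_eq_integral(1)[OF abs])
    show "s_flow (z t) (i, j)
        = s_flow (z 0) (i, j) + integral {0..t} (\<lambda>s. suscep S (i, j) * (w s i - w s j))"
      by (rule eq)
  qed
  have diff: "(\<lambda>s. w s i - w s j) integrable_on {0..t}" for i j
  proof (rule network_connected_induct[OF net,
        where R = "\<lambda>i j. (\<lambda>s. w s i - w s j) integrable_on {0..t}"])
    fix i j assume ij: "(i, j) \<in> lines S"
    show "(\<lambda>s. w s i - w s j) integrable_on {0..t}"
      using integrable_cmul[OF line[OF ij], of "1 / suscep S (i, j)"] suscep_pos[OF net ij]
      by simp
  next
    fix i j assume "(\<lambda>s. w s i - w s j) integrable_on {0..t}"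
    from integrable_neg[OF this] show "(\<lambda>s. w s j - w s i) integrable_on {0..t}" by simp
  next
    fix i j k
    assume "(\<lambda>s. w s i - w s j) integrable_on {0..t}" "(\<lambda>s. w s j - w s k) integrable_on {0..t}"
    from integrable_add[OF this] show "(\<lambda>s. w s i - w s k) integrable_on {0..t}" by simp
  qed (simp add: integrable_0)
  define r :: 'n where "r = undefined"
  define \<theta> where "\<theta> = (\<lambda>i. \<theta>0 i + integral {0..t} (\<lambda>s. w s i - w s r))"
  have "s_flow (z t) (i, j) = dc_flow S \<theta> (i, j)" if ij: "(i, j) \<in> lines S" for i j
  proof -
    have "integral {0..t} (\<lambda>s. w s i - w s r) - integral {0..t} (\<lambda>s. w s j - w s r)
        = integral {0..t} (\<lambda>s. w s i - w s j)"
      using integral_diff[OF diff[of i r] diff[of j r]] by simp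
    then have "dc_flow S \<theta> (i, j) = suscep S (i, j) * (\<theta>0 i - \<theta>0 j)
        + suscep S (i, j) * integral {0..t} (\<lambda>s. w s i - w s j)"
      by (simp add: dc_flow_line[OF net ij] \<theta>_def algebra_simps flip: distrib_left)
    then show ?thesis
      using flow[OF ij] init ij by (simp add: dc_flow_line[OF net ij])
  qed
  then show ?thesis by auto
qed

text \<open>
  The range of \<open>B C\<^sup>T\<close> is closed. Potentials of convergent flows need not converge, but their
  differences do, along every path; so the limit potential is taken relative to a fixed bus.
\<close>

lemma limit_of_potential_flows:
  fixes S :: "('n::finite, 'k) network"
  assumes net: "network_ok S"
    and lim: "\<And>e. e \<in> lines S \<Longrightarrow> ((\<lambda>t. F t e) \<longlongrightarrow> P e) G"
    and pot: "\<forall>\<^sub>F t in G. \<exists>\<theta>. \<forall>e \<in> lines S. F t e = dc_flow S \<theta> e"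
    and G: "G \<noteq> bot"
  shows "\<exists>\<psi>. \<forall>e \<in> lines S. P e = dc_flow S \<psi> e"
proof -
  define \<theta> where "\<theta> t = (SOME \<theta>. \<forall>e \<in> lines S. F t e = dc_flow S \<theta> e)" for t
  have \<theta>: "\<forall>\<^sub>F t in G. \<forall>e \<in> lines S. F t e = dc_flow S (\<theta> t) e"
    using pot unfolding \<theta>_def by (rule eventually_mono) (erule someI_ex)
  have line: "((\<lambda>t. \<theta> t i - \<theta> t j) \<longlongrightarrow> P (i, j) / suscep S (i, j)) G"
    if ij: "(i, j) \<in> lines S" for i j
  proof (rule Lim_transform_eventually)
    show "((\<lambda>t. F t (i, j) / suscep S (i, j)) \<longlongrightarrow> P (i, j) / suscep S (i, j)) G"
      using suscep_pos[OF net ij] by (intro tendsto_divide lim[OF ij] tendsto_const) simp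
    show "\<forall>\<^sub>F t in G. F t (i, j) / suscep S (i, j) = \<theta> t i - \<theta> t j"
      using \<theta>
    proof eventually_elim
      case (elim t)
      then have "F t (i, j) = suscep S (i, j) * (\<theta> t i - \<theta> t j)"
        using ij by (simp add: dc_flow_line[OF net])
      then show ?case using suscep_pos[OF net ij] by simp
    qed
  qed
  have "\<exists>l. ((\<lambda>t. \<theta> t i - \<theta> t j) \<longlongrightarrow> l) G" for i j
  proof (rule network_connected_induct[OF net,
        where R = "\<lambda>i j. \<exists>l. ((\<lambda>t. \<theta> t i - \<theta> t j) \<longlongrightarrow> l) G"])
    fix i j assume "\<exists>l. ((\<lambda>t. \<theta> t i - \<theta> t j) \<longlongrightarrow> l) G"
    then obtain l where "((\<lambda>t. \<theta> t i - \<theta> t j) \<longlongrightarrow> l) G" by blast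
    from tendsto_minus[OF this] show "\<exists>l. ((\<lambda>t. \<theta> t j - \<theta> t i) \<longlongrightarrow> l) G" by auto
  next
    fix i j k
    assume "\<exists>l. ((\<lambda>t. \<theta> t i - \<theta> t j) \<longlongrightarrow> l) G" "\<exists>l. ((\<lambda>t. \<theta> t j - \<theta> t k) \<longlongrightarrow> l) G"
    then obtain l m where "((\<lambda>t. \<theta> t i - \<theta> t j) \<longlongrightarrow> l) G" "((\<lambda>t. \<theta> t j - \<theta> t k) \<longlongrightarrow> m) G"
      by blast
    from tendsto_add[OF this] show "\<exists>l. ((\<lambda>t. \<theta> t i - \<theta> t k) \<longlongrightarrow> l) G" by auto
  qed (use line in auto)
  then obtain L where L: "\<And>i j. ((\<lambda>t. \<theta> t i - \<theta> t j) \<longlongrightarrow> L i j) G"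
    by metis
  define r :: 'n where "r = undefined"
  have "P (i, j) = dc_flow S (\<lambda>i. L i r) (i, j)" if ij: "(i, j) \<in> lines S" for i j
  proof -
    have "((\<lambda>t. \<theta> t i - \<theta> t j) \<longlongrightarrow> L i r - L j r) G"
      using tendsto_diff[OF L[of i r] L[of j r]] by simp
    from tendsto_unique[OF G line[OF ij] this] show ?thesis
      using suscep_pos[OF net ij] by (simp add: dc_flow_line[OF net ij] field_simps)
  qed
  then show ?thesis by auto
qed


section \<open>Optimal line flows\<close>

theorem theorem11:
  fixes S :: "('n::finite, 'k) network"
    and \<phi> :: "'n bvec" and P :: "'n lvec" and \<sigma> :: "('n, 'k) mults"
  assumes "network_ok S" and "gains_pos S" and "cost_assm S" and "slater_assm S"
    and "((\<phi>, P), \<sigma>) \<in> equilibria S \<union> primal_dual_optima S"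
  shows "(\<forall>k \<in> areas S. (\<Sum>e \<in> boundary S k. area_inc S k e * P e) = p_sched S k) \<and>
    ((\<exists>z \<theta>0. trajectory S z \<and> converges_to S z ((\<phi>, P), \<sigma>) \<and>
        (\<forall>e \<in> lines S. s_flow (z 0) e = dc_flow S \<theta>0 e)) \<longrightarrow>
     (\<forall>(i, j) \<in> lines S. P (i, j) = suscep S (i, j) * (\<phi> i - \<phi> j)) \<and>
     (\<forall>e \<in> lines S. p_min S e \<le> P e \<and> P e \<le> p_max S e))"
proof (intro conjI[OF _ impI])
  note net = assms(1)
  have bal: "\<And>i. inc_mult S P i = inc_mult S (dc_flow S \<phi>) i"
    and sched: "\<And>k. k \<in> areas S \<Longrightarrow> area_mult S (dc_flow S \<phi>) k = p_sched S k"
    and lims: "\<And>e. e \<in> lines S \<Longrightarrow> p_min S e \<le> dc_flow S \<phi> e \<and> dc_flow S \<phi> e \<le> p_max S e"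
    using assms(5) equilibrium_balance[OF net assms(2), of \<phi> P \<sigma>]
      optimum_balance[OF net assms(4), of \<phi> P \<sigma>]
    unfolding Un_iff by metis+
  show "\<forall>k \<in> areas S. (\<Sum>e \<in> boundary S k. area_inc S k e * P e) = p_sched S k"
    using sched by (simp add: area_mult_boundary area_export[OF net] bal)
  assume "\<exists>z \<theta>0. trajectory S z \<and> converges_to S z ((\<phi>, P), \<sigma>) \<and>
        (\<forall>e \<in> lines S. s_flow (z 0) e = dc_flow S \<theta>0 e)"
  then obtain z \<theta>0 where traj: "trajectory S z" and conv: "converges_to S z ((\<phi>, P), \<sigma>)"
    and init: "\<forall>e \<in> lines S. s_flow (z 0) e = dc_flow S \<theta>0 e"
    by blast
  have "\<exists>\<psi>. \<forall>e \<in> lines S. P e = dc_flow S \<psi> e"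
  proof (rule limit_of_potential_flows[OF net])
    show "((\<lambda>t. s_flow (z t) e) \<longlongrightarrow> P e) at_top" if "e \<in> lines S" for e
      using conv that by (simp add: converges_to_def)
    show "\<forall>\<^sub>F t in at_top. \<exists>\<theta>. \<forall>e \<in> lines S. s_flow (z t) e = dc_flow S \<theta> e"
      using eventually_ge_at_top[of 0]
      by eventually_elim (rule trajectory_flow_has_potential[OF net traj init])
  qed simp
  then obtain \<psi> where \<psi>: "\<And>e. e \<in> lines S \<Longrightarrow> P e = dc_flow S \<psi> e" by blast
  have "inc_mult S (dc_flow S \<psi>) i = inc_mult S (dc_flow S \<phi>) i" for i
    using bal[of i] \<psi> by (simp add: inc_mult_def)
  then have P: "P e = dc_flow S \<phi> e" if "e \<in> lines S" for e
    using dc_flow_eq_of_inc_mult_eq[OF net _ that] \<psi>[OF that] by metis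
  show "(\<forall>(i, j) \<in> lines S. P (i, j) = suscep S (i, j) * (\<phi> i - \<phi> j)) \<and>
     (\<forall>e \<in> lines S. p_min S e \<le> P e \<and> P e \<le> p_max S e)"
    using P lims by (auto simp: dc_flow_line[OF net])
qed

end
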